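(* Let $R$ be a commutative ring with unity, let $m\ge1$ be an integer, and let $\lambda_1:\mathbb N\times\mathbb Z\to R$ be a lambda-recursive family of order $m$ with principal factor $(p_n)$ and auxiliary factor $h_{(n,k)}=h_n$ independent of $k$. Let $\mathcal M_{(n,k)}$ denote the algebraic expansion matrix with base sequence $\lambda_1$. Then, for all $n\in\mathbb N$ and $1\le k\le w_m(n)$, $$|\mathcal M_{(n,k)}|=\Bigl(\prod_{j=1}^{k}p_{n-(j-1)m}\Bigr)|\mathcal M_{(n-1,k)}|-\Bigl(\prod_{j=1}^{k-1}p_{n-(j-1)m}\Bigr)h_{n-(k-1)m}\,\lambda_1(n-km,0)\,|\mathcal M_{(n-1,k-1)}|,$$ where $|\cdot|$ denotes the determinant.
   Context: $\mathbb N=\{0,1,2,\dots\}$ and $w_m(n)=\lfloor n/m\rfloor$. A family $\lambda:\mathbb N\times\mathbb Z\to R$ has triangular support of order $m$ (written $\lambda\in\Delta_m$) if $\lambda(n,k)=0$ whenever $k<0$ or $k>w_m(n)$. A family $\lambda_1\in\Delta_m$ is lambda-recursive of order $m$ if there exist $p_n\in R$ (principal factor), $h_{(n,k)}\in R$ (auxiliary factor) and initial data $c_n\in R$ for $0\le n\le m-1$ such that, for all $n\in\mathbb N$ and $0\le k\le w_m(n)$: $\lambda_1(n,0)=c_n$ if $0\le n\le m-1$ (and $k=0$), and $\lambda_1(n,k)=p_n\,\lambda_1(n-1,k)-h_{(n,k)}\,\lambda_1(n-m,k-1)$ if $n\ge m$. The algebraic expansion matrix with base sequence $\lambda_1$ is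 the $k\times k$ matrix $\mathcal M_{(n,k)}=(a_{ij})_{1\le i,j\le k}$ with $a_{ij}=\lambda_1\bigl(n-(j-1)m,\,i-j+1\bigr)$ if $j\le i+1$ and $a_{ij}=0$ if $j>i+1$. This formula is used for all $n\in\mathbb N$, $k\ge1$ with $n-(k-1)m\ge0$ (so that all first arguments are in $\mathbb N$), and the determinant of the empty matrix is $|\mathcal M_{(n,0)}|=1$. *)

theory Defs
  imports "Jordan_Normal_Form.Determinant"
begin

definition w :: "nat \<Rightarrow> nat \<Rightarrow> nat" where
  "w m n = n div m"

definition triangular_support :: "nat \<Rightarrow> (nat \<Rightarrow> int \<Rightarrow> 'a::zero) \<Rightarrow> bool" where
  "triangular_support m l \<longleftrightarrow> (\<forall>n k. k < 0 \<or> k > int (w m n) \<longrightarrow> l n k = 0)"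

text \<open>
  The parameters are the order \<open>m\<close>, the principal factor \<open>p\<close>, the auxiliary factor \<open>h\<close>, the
  initial data \<open>c\<close> (only \<open>c n\<close> with \<open>n < m\<close> is used) and the family \<open>l\<close>. The predicate is meant
  for \<open>m \<ge> 1\<close>; then the natural-number subtractions \<open>n - 1\<close> and \<open>n - m\<close> do not truncate.
\<close>

definition lambda_recursive ::
  "nat \<Rightarrow> (nat \<Rightarrow> 'a) \<Rightarrow> (nat \<Rightarrow> int \<Rightarrow> 'a) \<Rightarrow> (nat \<Rightarrow> 'a) \<Rightarrow> (nat \<Rightarrow> int \<Rightarrow> 'a::comm_ring_1) \<Rightarrow> bool"
where
  "lambda_recursive m p h c l \<longleftrightarrow>
     triangular_support m l \<and>
     (\<forall>n < m. l n 0 = c n) \<and>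
     (\<forall>n \<ge> m. \<forall>k. 0 \<le> k \<and> k \<le> int (w m n) \<longrightarrow>
        l n k = p n * l (n - 1) k - h n k * l (n - m) (k - 1))"

text \<open>
  Matrix indices start at 0, so with \<open>i\<close>, \<open>j\<close> denoting 1-based indices the entry at
  \<open>(i - 1, j - 1)\<close> is \<open>l (n - (j - 1) m) (i - j + 1)\<close> for \<open>j \<le> i + 1\<close> and 0 otherwise; the
  condition \<open>j \<le> i + 1\<close> and the difference \<open>i - j + 1\<close> are unaffected by the shift. The matrix is
  meant for \<open>(k - 1) * m \<le> n\<close>, where the subtraction \<open>n - j * m\<close> does not truncate.
\<close>

definition expansion_matrix ::
  "nat \<Rightarrow> (nat \<Rightarrow> int \<Rightarrow> 'a::zero) \<Rightarrow> nat \<Rightarrow> nat \<Rightarrow> 'a mat" where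
  "expansion_matrix m l n k =
     mat k k (\<lambda>(i, j). if j \<le> i + 1 then l (n - j * m) (int i - int j + 1) else 0)"

lemma det_expansion_matrix_0:
  "det (expansion_matrix m l n 0) = (1 :: 'a::comm_ring_1)"
  by (simp add: expansion_matrix_def det_def)

end

theory Submission
  imports Defs
begin

text \<open>
  Subject to the triangular support the recursion holds for every integer \<open>k\<close>, so column \<open>j\<close> of
  the matrix for \<open>n\<close> plus \<open>h (n - j m)\<close> times its column \<open>j + 1\<close> is \<open>p (n - j m)\<close> times column
  \<open>j\<close> of the matrix for \<open>n - 1\<close>. These column operations preserve the determinant. The last column
  has no successor; there the missing term only affects the bottom right entry, and expanding along
  the last column produces the second summand.
\<close>

text \<open>Outside \<open>0 \<le> k \<le> w m n\<close> all three terms vanish: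
  \<open>w m (n - 1)\<close> is at most \<open>w m n\<close>, and \<open>w m (n - m)\<close> is
  exactly one smaller, which matches the shift from \<open>k\<close> to
  \<open>k - 1\<close>.\<close>

lemma lambda_recursive_total:
  fixes l :: "nat \<Rightarrow> int \<Rightarrow> 'a::comm_ring_1"
  assumes m: "m \<ge> 1" and l: "lambda_recursive m p (\<lambda>n k. h n) c l" and n: "n \<ge> m"
  shows "l n k = p n * l (n - 1) k - h n * l (n - m) (k - 1)"
proof (cases "0 \<le> k \<and> k \<le> int (w m n)")
  case True
  then show ?thesis using l n unfolding lambda_recursive_def by blast
next
  case False
  have supp: "l n' k' = 0" if "k' < 0 \<or> k' > int (w m n')" for n' k'
    using l that unfolding lambda_recursive_def triangular_support_def by blast
  have "w m (n - 1) \<le> w m n"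
    by (simp add: w_def div_le_mono)
  moreover have "w m n = Suc (w m (n - m))"
    using m n by (simp add: w_def le_div_geq)
  ultimately have "l n k = 0" "l (n - 1) k = 0" "l (n - m) (k - 1) = 0"
    using False by (auto intro!: supp)
  then show ?thesis by simp
qed

text \<open>For \<open>j > i + 1\<close> the second argument is negative, so the support supplies
  the zero; column relations then need no case split.\<close>

lemma expansion_matrix_eq:
  assumes "triangular_support m l"
  shows "expansion_matrix m l n k =
    mat k k (\<lambda>(i, j). l (n - j * m) (int i - int j + 1))"
  using assms unfolding expansion_matrix_def triangular_support_def
  by (intro eq_matI) auto

text \<open>All column operations together are right multiplication by \<open>U\<close>, lower
  bidiagonal with unit diagonal.\<close>

lemma det_add_multiple_next_column:
  fixes a :: "nat \<Rightarrow> nat \<Rightarrow> 'a::comm_ring_1"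
  shows "det (mat k k (\<lambda>(i, j). a i j + (if Suc j < k then b j * a i (Suc j) else 0))) =
    det (mat k k (\<lambda>(i, j). a i j))"
proof -
  define U where "U = mat k k (\<lambda>(i, j). if i = j then 1 else if i = Suc j then b j else 0)"
  have U: "U \<in> carrier_mat k k" by (simp add: U_def)
  have "diag_mat U = replicate k 1"
    by (intro nth_equalityI) (auto simp: diag_mat_def U_def)
  then have det_U: "det U = 1"
    by (subst det_lower_triangular[OF _ U]) (auto simp: U_def)
  have "mat k k (\<lambda>(i, j). a i j + (if Suc j < k then b j * a i (Suc j) else 0)) =
    mat k k (\<lambda>(i, j). a i j) * U" (is "?L = ?R")
  proof (rule eq_matI)
    fix i j assume "i < dim_row ?R" "j < dim_col ?R"
    then have ij: "i < k" "j < k" by (auto simp: U_def)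
    have "?R $$ (i, j) =
        (\<Sum>t = 0..<k. a i t * (if t = j then 1 else if t = Suc j then b j else 0))"
      using ij by (simp add: U_def scalar_prod_def)
    also have "\<dots> = (\<Sum>t = 0..<k. (if t = j then a i t else 0) +
        (if t = Suc j then b j * a i t else 0))"
      by (intro sum.cong) (auto simp: mult.commute)
    \<comment> \<open>In the last column \<open>Suc j = k\<close> lies outside the summation range,
      hence the condition \<open>Suc j < k\<close>.\<close>
    also have "\<dots> = ?L $$ (i, j)"
      using ij by (simp add: sum.distrib)
    finally show "?L $$ (i, j) = ?R $$ (i, j)" by simp
  qed (auto simp: U_def)
  then show ?thesis
    using U by (simp add: det_mult[where n = k] det_U)
qed

lemma det_scale_columns:
  fixes a :: "nat \<Rightarrow> nat \<Rightarrow> 'a::comm_ring_1"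
  shows "det (mat k k (\<lambda>(i, j). d j * a i j)) = (\<Prod>j<k. d j) * det (mat k k (\<lambda>(i, j). a i j))"
proof -
  let ?A = "mat k k (\<lambda>(i, j). a i j)"
  have "mat k k (\<lambda>(i, j). d j * a i j) = ?A * mat_diag k d"
    by (subst mat_diag_mult_right[where n = k]) (auto simp: mult.commute)
  moreover have "det (mat_diag k d) = prod_list (diag_mat (mat_diag k d))"
    by (rule det_lower_triangular[where n = k]) (auto simp: mat_diag_def)
  moreover have "prod_list (diag_mat (mat_diag k d)) = (\<Prod>j<k. d j)"
    by (simp add: prod_list_diag_prod mat_diag_def lessThan_atLeast0)
  ultimately show ?thesis
    by (simp add: det_mult[where n = k] mult.commute)
qed

text \<open>Cofactors along the last column do not see that column, so both matrices share them; the
  corner cofactor has sign +1 and minor \<open>?C\<close>.\<close>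

lemma det_subtract_last_entry:
  fixes a :: "nat \<Rightarrow> nat \<Rightarrow> 'a::comm_ring_1"
  shows "det (mat (Suc k) (Suc k) (\<lambda>(i, j). a i j - (if i = k \<and> j = k then x else 0))) =
    det (mat (Suc k) (Suc k) (\<lambda>(i, j). a i j)) - x * det (mat k k (\<lambda>(i, j). a i j))"
    (is "det ?B = det ?A - x * det ?C")
proof -
  have cof: "cofactor ?B i k = cofactor ?A i k" if "i \<le> k" for i
  proof -
    have "mat_delete ?B i k = mat_delete ?A i k"
      using that by (intro eq_matI) (auto simp: mat_delete_def)
    then show ?thesis by (simp add: cofactor_def)
  qed
  have "mat_delete ?A k k = ?C"
    by (auto simp: mat_delete_def intro!: eq_matI)
  then have cof_C: "cofactor ?A k k = det ?C"
    by (simp add: cofactor_def)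
  have "det ?B = (\<Sum>i<Suc k. ?B $$ (i, k) * cofactor ?B i k)"
    by (rule laplace_expansion_column) auto
  also have "\<dots> = (\<Sum>i<Suc k. a i k * cofactor ?A i k -
      (if i = k then x * cofactor ?A i k else 0))"
    by (intro sum.cong) (auto simp: cof algebra_simps)
  also have "\<dots> = (\<Sum>i<Suc k. ?A $$ (i, k) * cofactor ?A i k) - x * det ?C"
    by (simp add: sum_subtractf cof_C)
  also have "(\<Sum>i<Suc k. ?A $$ (i, k) * cofactor ?A i k) = det ?A"
    by (rule laplace_expansion_column[symmetric]) auto
  finally show ?thesis .
qed

theorem theorem3p7:
  fixes l :: "nat \<Rightarrow> int \<Rightarrow> 'a::comm_ring_1"
    and p h c :: "nat \<Rightarrow> 'a"
    and m n k :: nat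
  assumes "m \<ge> 1"
    and "lambda_recursive m p (\<lambda>n k. h n) c l"
    and "1 \<le> k" and "k \<le> w m n"
  shows "det (expansion_matrix m l n k) =
      (\<Prod>j = 1..k. p (n - (j - 1) * m)) * det (expansion_matrix m l (n - 1) k)
    - (\<Prod>j = 1..k - 1. p (n - (j - 1) * m)) * h (n - (k - 1) * m) * l (n - k * m) 0
        * det (expansion_matrix m l (n - 1) (k - 1))"
proof -
  obtain q where k: "k = Suc q"
    using assms(3) by (cases k) auto
  have supp: "triangular_support m l"
    using assms(2) by (simp add: lambda_recursive_def)
  have "k * m \<le> n"
    using assms(1,4) by (simp add: w_def less_eq_div_iff_mult_less_eq)
  \<comment> \<open>From \<open>Suc j * m \<le> k * m \<le> n\<close>: the recursion applies in
    every column.\<close>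
  then have ge: "n - j * m \<ge> m" if "j < k" for j
    using that mult_le_mono1[of "Suc j" k m] by simp
  define a where "a n' i j = l (n' - j * m) (int i - int j + 1)" for n' i j
  define P where "P j = p (n - j * m)" for j
  define x where "x = h (n - q * m) * l (n - k * m) 0"
  have M: "expansion_matrix m l n' k' = mat k' k' (\<lambda>(i, j). a n' i j)" for n' k'
    by (simp add: expansion_matrix_eq[OF supp] a_def)
  have step: "a n i j = P j * a (n - 1) i j - h (n - j * m) * a n i (Suc j)" if "j < k" for i j
    using lambda_recursive_total[OF assms(1,2) ge[OF that], of "int i - int j + 1"]
    by (simp add: a_def P_def algebra_simps)
  \<comment> \<open>Column \<open>k\<close> lies just beyond the matrix. Its second argument
    \<open>i - k + 1\<close> is negative except in row \<open>q\<close>, where it is 0.\<close>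
  have last: "a n i k = (if i = q then l (n - k * m) 0 else 0)" if "i < k" for i
    using supp that by (auto simp: a_def k triangular_support_def)
  \<comment> \<open>For \<open>j < q\<close> this is \<open>step\<close> rearranged. For
    \<open>j = q\<close> the multiple of column \<open>k\<close> stays on the right, and by
    \<open>last\<close> only its corner entry \<open>x\<close> survives.\<close>
  have columns: "a n i j + (if Suc j < k then h (n - j * m) * a n i (Suc j) else 0) =
      P j * a (n - 1) i j - (if i = q \<and> j = q then x else 0)" if "i < k" "j < k" for i j
    using step[OF that(2), of i] last[OF that(1)] that by (auto simp: x_def k less_Suc_eq)
  have "det (expansion_matrix m l n k) =
      det (mat k k (\<lambda>(i, j). a n i j + (if Suc j < k then h (n - j * m) * a n i (Suc j) else 0)))"
    unfolding M by (rule det_add_multiple_next_column[symmetric])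
  also have "\<dots> = det (mat k k (\<lambda>(i, j). P j * a (n - 1) i j - (if i = q \<and> j = q then x else 0)))"
    by (intro arg_cong[where f = det] eq_matI) (simp_all add: columns)
  \<comment> \<open>Entries do not depend on the size of the matrix, so the corner minor is the
    matrix for \<open>n - 1\<close> of size \<open>q\<close>, with its columns scaled by
    \<open>P\<close>.\<close>
  also have "\<dots> = (\<Prod>j<k. P j) * det (expansion_matrix m l (n - 1) k)
      - x * ((\<Prod>j<q. P j) * det (expansion_matrix m l (n - 1) q))"
    unfolding k det_subtract_last_entry det_scale_columns M ..
  finally have det_eq: "det (expansion_matrix m l n k) =
      (\<Prod>j<k. P j) * det (expansion_matrix m l (n - 1) k)
      - x * ((\<Prod>j<q. P j) * det (expansion_matrix m l (n - 1) q))" .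
  have prod_eq: "(\<Prod>j<r. P j) = (\<Prod>j = 1..r. p (n - (j - 1) * m))" for r
    unfolding P_def by (rule prod.reindex_bij_witness[of _ "\<lambda>j. j - 1" Suc]) auto
  have q: "k - 1 = q"
    by (simp add: k)
  show ?thesis
    unfolding det_eq prod_eq q x_def by (simp only: mult_ac)
qed

end
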